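(* Let $x$ and $y$ be $q$-commuting variables, that is, $yx=qxy$. For any $n\in\mathbb{N}^{\ast}=\{0,1,2,3,\ldots\}$, we have $$G_{n,q}^{(\alpha)}(x+y)=\sum_{j=0}^{n}\binom{n}{j}_{q}\,y^{n-j}\,G_{j,q}^{(\alpha)}(x).$$
   Context: Let $q\in\mathbb{C}$ with $|q|<1$, and let $\alpha$ denote the order (a parameter on which no further restriction is stated). Put $[x]_q=\frac{1-q^x}{1-q}$, $[n]_q!=[n]_q[n-1]_q\cdots[1]_q$ (with $[0]_q!=1$), and $\binom{k}{n}_q=\frac{[k]_q[k-1]_q\cdots[k-n+1]_q}{[n]_q!}$. The $q$-exponential function is $e_q(z)=\sum_{l=0}^\infty \frac{z^l}{[l]_q!}$. The $q$-Genocchi polynomials of higher order (of order $\alpha$), $G_{n,q}^{(\alpha)}(x)$, are defined by the generating function $$\sum_{n=0}^{\infty}\frac{z^n}{[n]_q!}G_{n,q}^{(\alpha)}(x)=\left(\frac{[2]_q z}{e_q(z)+1}\right)^{\alpha}e_q(zx).$$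
   Formalization: With yx = qxy the printed order y^{n-j} G_j(x) is false (order 0, n = 2, xy ≠ 0: (x+y)^2 = x^2+(1+q)xy+y^2, not x^2+(1+q)yx+y^2); the formal statement has the powers of y on the right, G_j(x) y^{n-j}. *)

theory Defs
  imports "HOL-Complex_Analysis.Complex_Analysis"
begin

definition q_int :: "complex \<Rightarrow> nat \<Rightarrow> complex" where
  "q_int q n = (1 - q ^ n) / (1 - q)"

definition q_fact :: "complex \<Rightarrow> nat \<Rightarrow> complex" where
  "q_fact q n = (\<Prod>i = 1..n. q_int q i)"

text \<open>For \<open>n > k\<close> the truncated subtraction is harmless: the factor for \<open>i = k\<close> is \<open>q_int q 0 = 0\<close>.\<close>

definition q_binomial :: "complex \<Rightarrow> nat \<Rightarrow> nat \<Rightarrow> complex" where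
  "q_binomial q k n = (\<Prod>i<n. q_int q (k - i)) / q_fact q n"

text \<open>For \<open>|q| < 1\<close> the series converges exactly for \<open>|z| < 1 / |1 - q|\<close>.\<close>

definition q_exp :: "complex \<Rightarrow> complex \<Rightarrow> complex" where
  "q_exp q z = (\<Sum>l. z ^ l / q_fact q l)"

text \<open>
  \<open>is_q_genocchi q \<alpha> G\<close>: the polynomials \<open>G 0, G 1, \<dots>\<close> are the higher-order \<open>q\<close>-Genocchi
  polynomials of order \<open>\<alpha>\<close>, i.e. they satisfy the defining generating function identity for
  every number \<open>x\<close> and all small \<open>z\<close>.  The order is an arbitrary complex number and \<open>powr\<close> is the
  principal power; \<open>z = 0\<close> is left out because \<open>0 powr \<alpha> = 0\<close> even for \<open>\<alpha> = 0\<close>.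
  The left-hand side being a power series in \<open>z\<close>, such polynomials can only exist when
  \<open>\<alpha>\<close> is a natural number; \<open>is_q_genocchi_exists\<close> below shows that in this case they do.
\<close>

definition is_q_genocchi :: "complex \<Rightarrow> complex \<Rightarrow> (nat \<Rightarrow> complex poly) \<Rightarrow> bool" where
  "is_q_genocchi q \<alpha> G \<longleftrightarrow>
     (\<forall>x. \<forall>\<^sub>F z in at 0.
        (\<lambda>n. z ^ n / q_fact q n * poly (G n) x) sums
          ((q_int q 2 * z / (q_exp q z + 1)) powr \<alpha> * q_exp q (z * x)))"

text \<open>Associative, unital, not necessarily commutative algebras over the complex numbers.\<close>

locale complex_algebra = vector_space smul
  for smul :: "complex \<Rightarrow> 'a::ring_1 \<Rightarrow> 'a" +
  assumes smul_mult_left: "smul c a * b = smul c (a * b)"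
    and smul_mult_right: "a * smul c b = smul c (a * b)"

text \<open>Evaluation of a polynomial with complex coefficients at an element of such an algebra.\<close>

definition alg_poly :: "(complex \<Rightarrow> 'a::ring_1 \<Rightarrow> 'a) \<Rightarrow> complex poly \<Rightarrow> 'a \<Rightarrow> 'a" where
  "alg_poly smul p a = (\<Sum>i\<le>degree p. smul (coeff p i) (a ^ i))"

lemma q_int_neq_0:
  assumes "norm q < 1" "n > 0"
  shows "q_int q n \<noteq> 0"
proof -
  have "norm (q ^ n) < 1" using assms by (simp add: norm_power power_less_one_iff)
  then have "q ^ n \<noteq> 1" by auto
  moreover have "q \<noteq> 1" using assms by auto
  ultimately show ?thesis by (simp add: q_int_def)
qed

lemma q_fact_neq_0: "norm q < 1 \<Longrightarrow> q_fact q n \<noteq> 0"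
  by (simp add: q_fact_def q_int_neq_0)

lemma q_exp_has_fps_expansion:
  assumes "norm q < 1"
  shows "q_exp q has_fps_expansion Abs_fps (\<lambda>l. 1 / q_fact q l)"
proof -
  have lim: "(\<lambda>n. q_int q (Suc n)) \<longlonglongrightarrow> (1 - 0) / (1 - q)"
    unfolding q_int_def using assms
    by (intro tendsto_intros LIMSEQ_Suc[OF LIMSEQ_power_zero]) auto
  have "q \<noteq> 1" using assms by auto
  have "conv_radius (\<lambda>l. 1 / q_fact q l) = norm (1 / (1 - q))"
  proof (rule conv_radius_ratio_limit_nonzero)
    have "norm (1 / q_fact q n) / norm (1 / q_fact q (Suc n)) = norm (q_int q (Suc n))" for n
      using q_fact_neq_0[OF assms, of n] by (simp add: q_fact_def norm_mult norm_divide)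
    then show "(\<lambda>n. norm (1 / q_fact q n) / norm (1 / q_fact q (Suc n)))
        \<longlonglongrightarrow> norm (1 / (1 - q))"
      using tendsto_norm[OF lim] by simp
  qed (use \<open>q \<noteq> 1\<close> q_fact_neq_0[OF assms] in auto)
  then have "fps_conv_radius (Abs_fps (\<lambda>l. 1 / q_fact q l)) > 0"
    using \<open>q \<noteq> 1\<close> by (simp add: fps_conv_radius_def)
  moreover have "eval_fps (Abs_fps (\<lambda>l. 1 / q_fact q l)) = q_exp q"
    by (simp add: eval_fps_def q_exp_def fun_eq_iff)
  ultimately show ?thesis by (simp add: has_fps_expansion_def)
qed

lemma is_q_genocchi_exists:
  assumes q: "norm q < 1"
  shows "\<exists>G. is_q_genocchi q (of_nat m) G"
proof -
  define E where "E = Abs_fps (\<lambda>l. 1 / q_fact q l)"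
  have E: "q_exp q has_fps_expansion E"
    unfolding E_def by (rule q_exp_has_fps_expansion[OF q])
  have E1: "(\<lambda>z. q_exp q z + 1) has_fps_expansion (E + 1)"
    by (intro fps_expansion_intros E)
  have nz: "fps_nth (E + 1) 0 \<noteq> 0" by (simp add: E_def q_fact_def)
  define F where "F = (fps_const (q_int q 2) * fps_X / (E + 1)) ^ m"
  have F: "(\<lambda>z. (q_int q 2 * z / (q_exp q z + 1)) ^ m) has_fps_expansion F"
  proof -
    have base: "(\<lambda>z. q_int q 2 * z / (q_exp q z + 1)) has_fps_expansion
        fps_const (q_int q 2) * fps_X / (E + 1)"
      using nz by (intro has_fps_expansion_divide' E1) (auto intro!: fps_expansion_intros)
    show ?thesis
      unfolding F_def by (induction m) (simp_all only: power_0 power_Suc has_fps_expansion_1 has_fps_expansion_mult base)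
  qed
  define G where
    "G = (\<lambda>n. \<Sum>k\<le>n. monom (q_fact q n * fps_nth F (n - k) / q_fact q k) k)"
  have "\<forall>\<^sub>F z in at 0.
        (\<lambda>n. z ^ n / q_fact q n * poly (G n) x) sums
          ((q_int q 2 * z / (q_exp q z + 1)) powr of_nat m * q_exp q (z * x))" for x
  proof -
    define H where "H = Abs_fps (\<lambda>l. x ^ l / q_fact q l)"
    have "(q_exp q \<circ> (\<lambda>z. x * z)) has_fps_expansion (fps_compose E (fps_const x * fps_X))"
      by (intro fps_expansion_intros E) auto
    moreover have "fps_compose E (fps_const x * fps_X) = H"
      by (simp add: H_def E_def fps_compose_linear)
    ultimately have H: "(\<lambda>z. q_exp q (z * x)) has_fps_expansion H"
      by (simp add: o_def mult.commute)
    define P where "P = F * H"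
    have P: "(\<lambda>z. (q_int q 2 * z / (q_exp q z + 1)) ^ m * q_exp q (z * x)) has_fps_expansion P"
      unfolding P_def by (intro fps_expansion_intros F H)
    have coeff: "fps_nth P n = poly (G n) x / q_fact q n" for n
    proof -
      have "fps_nth P n = (\<Sum>k\<le>n. fps_nth H k * fps_nth F (n - k))"
        by (simp add: P_def fps_mult_nth mult.commute[of F] atLeast0AtMost)
      also have "\<dots> = poly (G n) x / q_fact q n"
        using q_fact_neq_0[OF q]
        by (simp add: G_def H_def poly_sum poly_monom sum_divide_distrib field_simps)
      finally show ?thesis .
    qed
    have "\<forall>\<^sub>F z in nhds 0. z \<in> eball 0 (fps_conv_radius P)"
      using P by (intro eventually_nhds_in_open) (auto simp: has_fps_expansion_def zero_ereal_def)
    then have 1: "\<forall>\<^sub>F z in at 0. z \<in> eball 0 (fps_conv_radius P)"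
      by (auto simp: eventually_at_filter elim: eventually_mono)
    have "\<forall>\<^sub>F z in nhds 0. eval_fps P z
        = (q_int q 2 * z / (q_exp q z + 1)) ^ m * q_exp q (z * x)"
      using P by (simp add: has_fps_expansion_def)
    then have 2: "\<forall>\<^sub>F z in at 0. eval_fps P z
        = (q_int q 2 * z / (q_exp q z + 1)) ^ m * q_exp q (z * x)"
      by (auto simp: eventually_at_filter elim: eventually_mono)
    have "isCont (\<lambda>z. q_exp q z + 1) 0"
      using has_fps_expansion_imp_continuous[OF E1, of UNIV] by simp
    moreover have "q_exp q 0 + 1 \<noteq> 0"
      using has_fps_expansion_imp_0_eq_fps_nth_0[OF E1] nz by simp
    ultimately have 3: "\<forall>\<^sub>F z in at 0. q_exp q z + 1 \<noteq> 0"
      by (intro tendsto_imp_eventually_ne) (simp_all add: isCont_def)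
    have 4: "\<forall>\<^sub>F z in at (0::complex). z \<noteq> 0"
      by (simp add: eventually_at_filter)
    show ?thesis
      using 1 2 3 4
    proof eventually_elim
      case (elim z)
      have "(\<lambda>n. fps_nth P n * z ^ n) sums eval_fps P z"
        using elim(1) by (intro sums_eval_fps) simp
      moreover have "q_int q 2 \<noteq> 0" using q_int_neq_0[OF q, of 2] by simp
      ultimately show ?case
        using elim(2-4) by (simp add: coeff powr_nat field_simps)
    qed
  qed
  then show ?thesis unfolding is_q_genocchi_def by blast
qed

end

theory Submission
  imports Defs
begin

text \<open>
  For an element \<open>a\<close> of a complex algebra let \<open>E(a) = (\<Sum>n. a\<^sup>n z\<^sup>n / [n]\<^sub>q!)\<close>, a formal power
  series in a central variable \<open>z\<close>.  The \<open>q\<close>-binomial theorem, in the form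
  \<open>E(x + y) = E(x) E(y)\<close> whenever \<open>y x = q x y\<close> (lemma \<open>alg_q_exp_add\<close>), is where the
  \<open>q\<close>-commutation enters, and it is also what forces the powers of \<open>y\<close> to stand to the right of the
  polynomials in \<open>x\<close>.

  The generating function factors as \<open>A(z) e\<^sub>q(z x)\<close> with \<open>A\<close> independent of \<open>x\<close>.  At \<open>x = 0\<close> it
  shows that \<open>A\<close> agrees near \<open>0\<close> with the power series whose coefficients are \<open>G\<^sub>n(0) / [n]\<^sub>q!\<close>; so,
  whatever the order \<open>\<alpha>\<close> is, comparing coefficients expresses \<open>G\<^sub>n\<close> through the numbers \<open>G\<^sub>k(0)\<close>
  (lemma \<open>q_genocchi_expansion\<close>).  Being an identity between polynomials, this may be evaluated
  in the algebra, where it says \<open>(\<Sum>n. G\<^sub>n(a) z\<^sup>n / [n]\<^sub>q!) = A E(a)\<close>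
  (lemma \<open>alg_q_genocchi_gen\<close>).  The theorem is the coefficient of \<open>z\<^sup>n\<close> in
  \<open>A E(x + y) = (A E(x)) E(y)\<close>.
\<close>

section \<open>Factorials and binomial coefficients\<close>

lemma q_fact_Suc: "q_fact q (Suc n) = q_int q (Suc n) * q_fact q n"
  by (simp add: q_fact_def mult.commute)

lemma q_int_add:
  assumes "norm q < 1"
  shows "q_int q (i + j) = q_int q i + q ^ i * q_int q j"
proof -
  have "q \<noteq> 1" using assms by auto
  then show ?thesis by (simp add: q_int_def power_add field_simps)
qed

lemma q_binomial_eq_q_fact:
  assumes q: "norm q < 1" and "j \<le> n"
  shows "q_binomial q n j = q_fact q n / (q_fact q j * q_fact q (n - j))"
proof -
  have "(\<Prod>i<j. q_int q (n - i)) * q_fact q (n - j) = q_fact q n"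
    using \<open>j \<le> n\<close>
  proof (induction j)
    case (Suc j)
    then have "q_fact q (n - j) = q_int q (n - j) * q_fact q (n - Suc j)"
      using q_fact_Suc[of q "n - Suc j"] by (simp add: Suc_diff_Suc)
    with Suc show ?case by (simp add: mult.assoc)
  qed simp
  then show ?thesis
    using q_fact_neq_0[OF q] by (simp add: q_binomial_def field_simps)
qed

section \<open>The polynomials in terms of their values at zero\<close>

text \<open>
  The generating function identity is only known for \<open>z \<noteq> 0\<close>.  A Laurent expansion depends on a
  punctured neighbourhood alone, so it can be multiplied and compared without discussing the
  value at \<open>0\<close>.
\<close>

lemma sums_imp_has_laurent_expansion:
  fixes f :: "complex \<Rightarrow> complex"
  assumes "\<forall>\<^sub>F z in at 0. (\<lambda>n. c n * z ^ n) sums f z"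
  shows "f has_laurent_expansion fps_to_fls (Abs_fps c)"
proof -
  have "\<forall>\<^sub>F z in at (0::complex). z \<noteq> 0"
    by (simp add: eventually_at_filter)
  with assms have "\<forall>\<^sub>F z in at 0. (\<lambda>n. c n * z ^ n) sums f z \<and> z \<noteq> 0"
    by (rule eventually_conj)
  \<comment> \<open>convergence at a single nonzero point makes the radius of convergence positive\<close>
  then obtain w where w: "(\<lambda>n. c n * w ^ n) sums f w" "w \<noteq> 0"
    using eventually_happens'[OF at_neq_bot] by blast
  have "0 < ereal (norm w)"
    using w(2) by simp
  also have "\<dots> \<le> fps_conv_radius (Abs_fps c)"
    unfolding fps_conv_radius_def using w(1)
    by (intro conv_radius_geI) (simp add: sums_iff)
  finally have "fps_conv_radius (Abs_fps c) > 0" .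
  then have "eval_fps (Abs_fps c) has_laurent_expansion fps_to_fls (Abs_fps c)"
    by (intro has_laurent_expansion_fps) (simp add: has_fps_expansion_def)
  moreover have "\<forall>\<^sub>F z in at 0. eval_fps (Abs_fps c) z = f z"
    using assms by eventually_elim (simp add: eval_fps_def sums_iff)
  ultimately show ?thesis
    using has_laurent_expansion_cong by blast
qed

lemma q_exp_mult_has_fps_expansion:
  assumes "norm q < 1"
  shows "(\<lambda>z. q_exp q (z * x)) has_fps_expansion Abs_fps (\<lambda>l. x ^ l / q_fact q l)"
proof -
  have "(q_exp q \<circ> (\<lambda>z. x * z)) has_fps_expansion
      fps_compose (Abs_fps (\<lambda>l. 1 / q_fact q l)) (fps_const x * fps_X)"
    by (intro fps_expansion_intros q_exp_has_fps_expansion[OF assms]) auto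
  moreover have "fps_compose (Abs_fps (\<lambda>l. 1 / q_fact q l)) (fps_const x * fps_X) =
      Abs_fps (\<lambda>l. x ^ l / q_fact q l)"
    by (simp add: fps_compose_linear)
  ultimately show ?thesis
    by (simp add: o_def mult.commute)
qed

text \<open>
  With \<open>A\<close> read off from the case \<open>x = 0\<close>, the coefficient of \<open>z\<^sup>n\<close> in \<open>A(z) e\<^sub>q(z x)\<close> is the
  right-hand side divided by \<open>[n]\<^sub>q!\<close>, for every number \<open>x\<close>.  The factor is kept in this unreduced
  form because it displays \<open>G\<^sub>n\<close> as a convolution.
\<close>

lemma q_genocchi_expansion:
  assumes q: "norm q < 1" and G: "is_q_genocchi q \<alpha> G"
  shows "G n = (\<Sum>k\<le>n. monom
    (q_fact q n * (1 / q_fact q k) * (poly (G (n - k)) 0 / q_fact q (n - k))) k)"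
proof (rule poly_ext)
  fix x :: complex
  define A where "A = (\<lambda>z. (q_int q 2 * z / (q_exp q z + 1)) powr \<alpha>)"
  define P where "P = (\<lambda>t. Abs_fps (\<lambda>n. poly (G n) t / q_fact q n))"
  define H where "H = Abs_fps (\<lambda>l. x ^ l / q_fact q l)"
  have gen: "(\<lambda>z. A z * q_exp q (z * t)) has_laurent_expansion fps_to_fls (P t)" for t
    unfolding P_def A_def
    using G[unfolded is_q_genocchi_def, rule_format, of t]
    by (intro sums_imp_has_laurent_expansion) (simp add: mult.commute)
  have "q_exp q 0 = 1"
    using has_fps_expansion_imp_0_eq_fps_nth_0[OF q_exp_has_fps_expansion[OF q]]
    by (simp add: q_fact_def)
  then have "A has_laurent_expansion fps_to_fls (P 0)"
    using gen[of 0] by simp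
  then have "(\<lambda>z. A z * q_exp q (z * x)) has_laurent_expansion fps_to_fls (P 0) * fps_to_fls H"
    unfolding H_def
    by (rule has_laurent_expansion_mult[OF _
        has_laurent_expansion_fps[OF q_exp_mult_has_fps_expansion[OF q]]])
  then have "fps_to_fls (P x) = fps_to_fls (H * P 0)"
    using has_laurent_expansion_unique[OF gen[of x]] by (simp add: fls_times_fps_to_fls mult.commute)
  then have "fps_nth (P x) n = fps_nth (H * P 0) n"
    by simp
  then have "poly (G n) x = q_fact q n *
      (\<Sum>k\<le>n. x ^ k / q_fact q k * (poly (G (n - k)) 0 / q_fact q (n - k)))"
    using q_fact_neq_0[OF q, of n]
    by (simp add: P_def H_def fps_mult_nth atLeast0AtMost field_simps)
  then show "poly (G n) x = poly (\<Sum>k\<le>n. monom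
      (q_fact q n * (1 / q_fact q k) * (poly (G (n - k)) 0 / q_fact q (n - k))) k) x"
    by (simp add: poly_sum poly_monom sum_distrib_left mult_ac)
qed

section \<open>Generating functions over a noncommutative algebra\<close>

lemma alg_poly_altdef:
  assumes "complex_algebra smul" and "degree p \<le> N"
  shows "alg_poly smul p a = (\<Sum>i\<le>N. smul (coeff p i) (a ^ i))"
proof -
  interpret complex_algebra smul by fact
  show ?thesis
    unfolding alg_poly_def using assms(2)
    by (intro sum.mono_neutral_left) (auto simp: coeff_eq_0)
qed

definition alg_q_exp :: "(complex \<Rightarrow> 'a::ring_1 \<Rightarrow> 'a) \<Rightarrow> complex \<Rightarrow> 'a \<Rightarrow> 'a fps" where
  "alg_q_exp smul q a = Abs_fps (\<lambda>n. smul (1 / q_fact q n) (a ^ n))"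

text \<open>
  Moving \<open>y\<close> to the right past \<open>x\<^sup>i\<close> costs \<open>q\<^sup>i\<close>, which is exactly the weight in
  \<open>[i + j] = [i] + q\<^sup>i [j]\<close>.  Hence the coefficients \<open>c\<^sub>n\<close> of \<open>E(x) E(y)\<close> satisfy
  \<open>[n + 1] c\<^sub>n\<^sub>+\<^sub>1 = (x + y) c\<^sub>n\<close>, the recursion that determines the coefficients of \<open>E(x + y)\<close>.
\<close>

lemma alg_q_exp_add:
  fixes x y :: "'a::ring_1"
  assumes q: "norm q < 1" and alg: "complex_algebra smul" and comm: "y * x = smul q (x * y)"
  shows "alg_q_exp smul q (x + y) = alg_q_exp smul q x * alg_q_exp smul q y"
proof -
  interpret complex_algebra smul by fact
  define u where "u = (\<lambda>n. smul (1 / q_fact q n) (x ^ n))"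
  define v where "v = (\<lambda>n. smul (1 / q_fact q n) (y ^ n))"
  define c where "c = (\<lambda>n. \<Sum>i\<le>n. u i * v (n - i))"
  have step: "smul (q_int q (Suc n)) (smul (1 / q_fact q (Suc n)) (a ^ Suc n)) =
      a * smul (1 / q_fact q n) (a ^ n)" for a :: 'a and n
    using q_int_neq_0[OF q, of "Suc n"]
    by (simp add: q_fact_Suc smul_mult_right)
  have u_Suc: "smul (q_int q (Suc n)) (u (Suc n)) = x * u n" for n
    unfolding u_def by (rule step)
  have v_Suc: "smul (q_int q (Suc n)) (v (Suc n)) = y * v n" for n
    unfolding v_def by (rule step)
  have y_power: "y * x ^ i = smul (q ^ i) (x ^ i * y)" for i
  proof (induction i)
    case (Suc i)
    have "y * x ^ Suc i = smul q (x * (y * x ^ i))"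
      by (simp add: comm smul_mult_left mult.assoc flip: mult.assoc[of y])
    then show ?case
      by (simp add: Suc smul_mult_right mult.assoc)
  qed simp
  have y_u: "y * u i = smul (q ^ i) (u i * y)" for i
    by (simp add: u_def smul_mult_left smul_mult_right y_power mult.commute)
  have c_Suc: "smul (q_int q (Suc n)) (c (Suc n)) = (x + y) * c n" for n
  proof -
    have "smul (q_int q (Suc n)) (c (Suc n)) =
        (\<Sum>i\<le>Suc n. smul (q_int q i + q ^ i * q_int q (Suc n - i)) (u i * v (Suc n - i)))"
      unfolding c_def scale_sum_right
    proof (intro sum.cong refl)
      fix i assume "i \<in> {..Suc n}"
      then show "smul (q_int q (Suc n)) (u i * v (Suc n - i)) =
          smul (q_int q i + q ^ i * q_int q (Suc n - i)) (u i * v (Suc n - i))"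
        using q_int_add[OF q, of i "Suc n - i"] by simp
    qed
    also have "\<dots> = (\<Sum>i\<le>Suc n. smul (q_int q i) (u i) * v (Suc n - i)) +
        (\<Sum>i\<le>Suc n. smul (q ^ i) (u i * smul (q_int q (Suc n - i)) (v (Suc n - i))))"
      by (simp only: scale_left_distrib sum.distrib smul_mult_left smul_mult_right scale_scale)
    \<comment> \<open>the terms \<open>i = 0\<close> and \<open>i = Suc n\<close> drop out of the two sums because \<open>[0] = 0\<close>\<close>
    also have "(\<Sum>i\<le>Suc n. smul (q_int q i) (u i) * v (Suc n - i)) = x * c n"
      by (subst sum.atMost_Suc_shift)
        (simp add: u_Suc c_def sum_distrib_left mult.assoc q_int_def[of q 0])
    also have "(\<Sum>i\<le>Suc n. smul (q ^ i) (u i * smul (q_int q (Suc n - i)) (v (Suc n - i)))) =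
        (\<Sum>i\<le>n. smul (q ^ i) (u i * smul (q_int q (Suc n - i)) (v (Suc n - i))))"
      by (simp add: q_int_def[of q 0])
    also have "\<dots> = y * c n"
      unfolding c_def sum_distrib_left
      by (intro sum.cong refl)
        (simp add: Suc_diff_le v_Suc y_u smul_mult_left flip: mult.assoc)
    finally show ?thesis by (simp add: distrib_right)
  qed
  have "smul (1 / q_fact q n) ((x + y) ^ n) = c n" for n
  proof (induction n)
    case 0
    show ?case by (simp add: c_def u_def v_def q_fact_def)
  next
    case (Suc n)
    have "smul (q_int q (Suc n)) (smul (1 / q_fact q (Suc n)) ((x + y) ^ Suc n)) =
        smul (q_int q (Suc n)) (c (Suc n))"
      unfolding step Suc c_Suc ..
    then show ?case
      using q_int_neq_0[OF q, of "Suc n"] scale_left_imp_eq by blast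
  qed
  then show ?thesis
    by (simp add: fps_eq_iff alg_q_exp_def fps_mult_nth atLeast0AtMost c_def u_def v_def)
qed

text \<open>
  The scalar series \<open>A\<close> enters as a series over the algebra, with each coefficient \<open>c\<close> replaced by
  \<open>c\<close> times the unit; it stands on the left, so a further factor \<open>E(y)\<close> on the right is absorbed
  by associativity.
\<close>

lemma alg_q_genocchi_gen:
  assumes q: "norm q < 1" and G: "is_q_genocchi q \<alpha> G" and alg: "complex_algebra smul"
  shows "Abs_fps (\<lambda>n. smul (1 / q_fact q n) (alg_poly smul (G n) a)) =
    Abs_fps (\<lambda>n. smul (poly (G n) 0 / q_fact q n) 1) * alg_q_exp smul q a"
proof (rule fps_ext)
  interpret complex_algebra smul by fact
  fix n
  have coeff: "coeff (G n) k =
      (if k \<le> n then q_fact q n * (1 / q_fact q k) * (poly (G (n - k)) 0 / q_fact q (n - k))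
       else 0)" for k
    by (subst q_genocchi_expansion[OF q G]) (simp add: coeff_sum)
  then have "degree (G n) \<le> n"
    by (intro degree_le) simp
  then have "smul (1 / q_fact q n) (alg_poly smul (G n) a) =
      (\<Sum>k\<le>n. smul (poly (G (n - k)) 0 / q_fact q (n - k)) 1 * smul (1 / q_fact q k) (a ^ k))"
    using q_fact_neq_0[OF q]
    by (simp add: alg_poly_altdef[OF alg] coeff scale_sum_right smul_mult_left mult.commute)
  also have "\<dots> = (\<Sum>k\<le>n. smul (poly (G k) 0 / q_fact q k) 1 *
      smul (1 / q_fact q (n - k)) (a ^ (n - k)))"
    by (subst sum.nat_diff_reindex[symmetric, of _ "Suc n", unfolded lessThan_Suc_atMost]) simp
  finally show "fps_nth (Abs_fps (\<lambda>n. smul (1 / q_fact q n) (alg_poly smul (G n) a))) n =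
      fps_nth (Abs_fps (\<lambda>n. smul (poly (G n) 0 / q_fact q n) 1) * alg_q_exp smul q a) n"
    by (simp add: fps_mult_nth atLeast0AtMost alg_q_exp_def)
qed

section \<open>The addition formula\<close>

theorem theorem2p3:
  fixes q \<alpha> :: complex
    and G :: "nat \<Rightarrow> complex poly"
    and smul :: "complex \<Rightarrow> 'a::ring_1 \<Rightarrow> 'a"
    and x y :: 'a
    and n :: nat
  assumes "norm q < 1"
    and "is_q_genocchi q \<alpha> G"
    and "complex_algebra smul"
    and "y * x = smul q (x * y)"
  shows "alg_poly smul (G n) (x + y) =
    (\<Sum>j = 0..n. smul (q_binomial q n j) (alg_poly smul (G j) x * y ^ (n - j)))"
proof -
  interpret complex_algebra smul by fact
  define P where "P = (\<lambda>a. Abs_fps (\<lambda>n. smul (1 / q_fact q n) (alg_poly smul (G n) a)))"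
  have "P (x + y) = P x * alg_q_exp smul q y"
    unfolding P_def alg_q_genocchi_gen[OF assms(1-3)] alg_q_exp_add[OF assms(1,3,4)]
    by (simp add: mult.assoc)
  then have "fps_nth (P (x + y)) n = fps_nth (P x * alg_q_exp smul q y) n"
    by simp
  then have "smul (1 / q_fact q n) (alg_poly smul (G n) (x + y)) =
      (\<Sum>j = 0..n. smul (1 / q_fact q j * (1 / q_fact q (n - j)))
        (alg_poly smul (G j) x * y ^ (n - j)))"
    by (simp add: P_def alg_q_exp_def fps_mult_nth smul_mult_left smul_mult_right mult.commute)
  then have "smul (q_fact q n) (smul (1 / q_fact q n) (alg_poly smul (G n) (x + y))) =
      (\<Sum>j = 0..n. smul (q_binomial q n j) (alg_poly smul (G j) x * y ^ (n - j)))"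
    by (simp add: scale_sum_right q_binomial_eq_q_fact[OF assms(1)])
  then show ?thesis
    using q_fact_neq_0[OF assms(1)] by simp
qed

end
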